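(* Let $\Omega$ be a finite set, $f:2^\Omega\to\mathbb{R}_{\ge0}$ a submodular function with $f(\emptyset)=0$ (not necessarily monotone), $X\subseteq\Omega$, $k$ a positive integer, and let $\mathrm{OPT}=\max_{C\subseteq X,\,|C|\le k} f(C)$. Let $\alpha\ge1$ and let $\mathrm{FMV}_\alpha$ be any algorithm which, given a set $S$, returns $T\subseteq S$ with $f(T)\ge\frac1\alpha\max_{T'\subseteq S}f(T')$. Consider the algorithm Submod-Max-Cardinality: set $X_1=X$; for $i=1,2$: let $S_i$ be the output of the greedy algorithm on $X_i$ with cardinality bound $k$, let $S_i'=\mathrm{FMV}_\alpha(S_i)$, and let $X_{i+1}=X_i\setminus S_i$; finally return the set of largest $f$-value among $S_1,S_1',S_2$. Then the returned set $S$ satisfies $S\subseteq X$, $|S|\le k$ and $f(S)\ge \frac{1}{4+\alpha}\,\mathrm{OPT}$.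
   Context: A function $f:2^\Omega\to\mathbb{R}$ is submodular if $f(A)+f(B)\ge f(A\cup B)+f(A\cap B)$ for all $A,B\subseteq\Omega$. The greedy algorithm on a set $Y$ with cardinality bound $k$ starts with $S=\emptyset$ and repeatedly adds an element $e\in Y\setminus S$ maximizing $f(S\cup\{e\})-f(S)$ until $|S|=k$ or $S=Y$. *)

theory Defs
  imports Complex_Main
begin

definition submodular_on :: "'a set \<Rightarrow> ('a set \<Rightarrow> real) \<Rightarrow> bool" where
  "submodular_on \<Omega> f \<longleftrightarrow>
     (\<forall>A B. A \<subseteq> \<Omega> \<longrightarrow> B \<subseteq> \<Omega> \<longrightarrow> f A + f B \<ge> f (A \<union> B) + f (A \<inter> B))"

text \<open>
  Ties in the greedy choice are left unresolved: the predicate below holds of every set that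
  occurs as the current set in some run of the greedy algorithm on \<open>Y\<close> with cardinality
  bound \<open>k\<close>. An element of maximal marginal value is added even if that value is negative.
\<close>

inductive greedy_reach :: "('a set \<Rightarrow> real) \<Rightarrow> 'a set \<Rightarrow> nat \<Rightarrow> 'a set \<Rightarrow> bool"
  for f :: "'a set \<Rightarrow> real" and Y :: "'a set" and k :: nat where
  start: "greedy_reach f Y k {}"
| step: "greedy_reach f Y k (S \<union> {e})"
    if "greedy_reach f Y k S" and "card S \<noteq> k" and "S \<noteq> Y"
      and "is_arg_max (\<lambda>e. f (S \<union> {e}) - f S) (\<lambda>e. e \<in> Y - S) e"

definition greedy_output :: "('a set \<Rightarrow> real) \<Rightarrow> 'a set \<Rightarrow> nat \<Rightarrow> 'a set \<Rightarrow> bool" where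
  "greedy_output f Y k S \<longleftrightarrow> greedy_reach f Y k S \<and> (card S = k \<or> S = Y)"

definition FMV_approx :: "'a set \<Rightarrow> ('a set \<Rightarrow> real) \<Rightarrow> real \<Rightarrow> ('a set \<Rightarrow> 'a set) \<Rightarrow> bool" where
  "FMV_approx \<Omega> f \<alpha> FMV \<longleftrightarrow>
     (\<forall>S. S \<subseteq> \<Omega> \<longrightarrow> FMV S \<subseteq> S \<and> f (FMV S) \<ge> (1 / \<alpha>) * Max (f ` Pow S))"

text \<open>
  \<open>R\<close> is a possible result of Submod-Max-Cardinality; \<open>Xs i\<close>, \<open>S i\<close> and \<open>S' i\<close> are the values
  of the program variables with index \<open>i\<close>. The value \<open>S' 2\<close> is computed but not used.
\<close>

definition submod_max_cardinality ::
    "('a set \<Rightarrow> real) \<Rightarrow> ('a set \<Rightarrow> 'a set) \<Rightarrow> 'a set \<Rightarrow> nat \<Rightarrow> 'a set \<Rightarrow> bool" where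
  "submod_max_cardinality f FMV X k R \<longleftrightarrow>
     (\<exists>Xs S S' :: nat \<Rightarrow> 'a set.
        Xs 1 = X \<and>
        (\<forall>i\<in>{1, 2}. greedy_output f (Xs i) k (S i) \<and> S' i = FMV (S i) \<and> Xs (i + 1) = Xs i - S i) \<and>
        is_arg_max f (\<lambda>T. T \<in> {S 1, S' 1, S 2}) R)"

definition OPT :: "('a set \<Rightarrow> real) \<Rightarrow> 'a set \<Rightarrow> nat \<Rightarrow> real" where
  "OPT f X k = Max (f ` {C. C \<subseteq> X \<and> card C \<le> k})"

text \<open>Every run can be completed, so statements about all results are not vacuous.\<close>

lemma ex_is_arg_max_finite:
  fixes g :: "'b \<Rightarrow> real"
  assumes "finite A" "A \<noteq> {}"
  shows "\<exists>x. is_arg_max g (\<lambda>x. x \<in> A) x"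
proof -
  have "Max (g ` A) \<in> g ` A" using assms by simp
  then obtain x where "x \<in> A" "g x = Max (g ` A)" by auto
  then show ?thesis
    using assms unfolding is_arg_max_linorder by (metis Max_ge finite_imageI imageI)
qed

lemma greedy_reach_card:
  assumes "finite Y" "n \<le> k" "n \<le> card Y"
  shows "\<exists>S. greedy_reach f Y k S \<and> S \<subseteq> Y \<and> card S = n"
  using assms(2,3)
proof (induction n)
  case 0
  show ?case using greedy_reach.start[of f Y k] by (intro exI[of _ "{}"]) simp
next
  case (Suc n)
  then obtain S where S: "greedy_reach f Y k S" "S \<subseteq> Y" "card S = n" by auto
  have ne: "card S \<noteq> k" "S \<noteq> Y" using S Suc.prems by auto
  then have "Y - S \<noteq> {}" using S by blast
  then obtain e where e: "is_arg_max (\<lambda>e. f (S \<union> {e}) - f S) (\<lambda>e. e \<in> Y - S) e"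
    using ex_is_arg_max_finite[of "Y - S"] assms(1) by blast
  then have "e \<in> Y - S" by (simp add: is_arg_max_def)
  moreover have "finite S" using S(2) assms(1) finite_subset by blast
  ultimately show ?case
    using greedy_reach.step[OF S(1) ne e] S by (intro exI[of _ "S \<union> {e}"]) auto
qed

lemma greedy_output_exists:
  assumes "finite Y"
  shows "\<exists>S. greedy_output f Y k S"
proof -
  obtain S where "greedy_reach f Y k S" "S \<subseteq> Y" "card S = min k (card Y)"
    using greedy_reach_card[OF assms, of "min k (card Y)" k f] by auto
  then have "greedy_output f Y k S"
    unfolding greedy_output_def using card_subset_eq[OF assms, of S] by (auto simp: min_def split: if_splits)
  then show ?thesis by blast
qed

lemma submod_max_cardinality_exists:
  assumes "finite X"
  shows "\<exists>R. submod_max_cardinality f FMV X k R"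
proof -
  obtain S1 where S1: "greedy_output f X k S1"
    using greedy_output_exists[OF assms] by blast
  obtain S2 where S2: "greedy_output f (X - S1) k S2"
    using greedy_output_exists[of "X - S1"] assms by blast
  obtain R where R: "is_arg_max f (\<lambda>T. T \<in> {S1, FMV S1, S2}) R"
    using ex_is_arg_max_finite[of "{S1, FMV S1, S2}" f] by blast
  let ?S = "\<lambda>i::nat. if i = 1 then S1 else S2"
  let ?X = "\<lambda>i::nat. if i = 1 then X else if i = 2 then X - S1 else X - S1 - S2"
  have "submod_max_cardinality f FMV X k R"
    unfolding submod_max_cardinality_def
    by (rule exI[of _ ?X], rule exI[of _ ?S], rule exI[of _ "\<lambda>i. FMV (?S i)"])
      (use S1 S2 R in simp)
  then show ?thesis by blast
qed

end

theory Submission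
  imports Defs
begin

text \<open>
  Let \<open>C\<close> be optimal. The final marginal \<open>m\<close> of any unchosen element is at most the gain of each
  greedy step, so a greedy set of size \<open>k\<close> has value at least \<open>k * m\<close>, and therefore
  \<open>2 * f S \<ge> f (S \<union> C)\<close>. Applying this to \<open>S\<^sub>1\<close> with \<open>C\<close> and to \<open>S\<^sub>2\<close> with \<open>C - S\<^sub>1\<close>,
  and using submodularity with \<open>S\<^sub>1 \<inter> S\<^sub>2 = {}\<close>, bounds \<open>f (C - S\<^sub>1)\<close> by
  \<open>2 * f S\<^sub>1 + 2 * f S\<^sub>2\<close>; the remaining part \<open>C \<inter> S\<^sub>1\<close> is bounded by \<open>\<alpha> * f (FMV S\<^sub>1)\<close>.
\<close>

lemma submodular_onD:
  assumes "submodular_on \<Omega> f" "A \<subseteq> \<Omega>" "B \<subseteq> \<Omega>"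
  shows "f (A \<union> B) + f (A \<inter> B) \<le> f A + f B"
  using assms unfolding submodular_on_def by blast

text \<open>Diminishing returns: this is submodularity for \<open>B\<close> and
  \<open>insert c A\<close>, which meet exactly in \<open>A\<close> because \<open>c\<close> lies
  outside \<open>B\<close>.\<close>

lemma submodular_on_marginal_antimono:
  assumes sub: "submodular_on \<Omega> f" and "insert c B \<subseteq> \<Omega>" "A \<subseteq> B" "c \<notin> B"
  shows "f (insert c B) - f B \<le> f (insert c A) - f A"
proof -
  have "B \<union> insert c A = insert c B" "B \<inter> insert c A = A"
    using assms by auto
  moreover have "B \<subseteq> \<Omega>" "insert c A \<subseteq> \<Omega>" using assms by auto
  ultimately show ?thesis using submodular_onD[OF sub, of B "insert c A"] by simp
qed

text \<open>Add the elements of \<open>D\<close> one at a time: by diminishing returns each gains at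
  most its marginal over \<open>S\<close>. The bound \<open>m\<close> may be negative.\<close>

lemma submodular_on_union_le:
  assumes sub: "submodular_on \<Omega> f" and "S \<subseteq> \<Omega>"
    and "finite D" "D \<subseteq> \<Omega>" "D \<inter> S = {}"
    and marg: "\<And>c. c \<in> D \<Longrightarrow> f (insert c S) - f S \<le> m"
  shows "f (S \<union> D) - f S \<le> real (card D) * m"
  using assms(3-6)
proof (induction D rule: finite_induct)
  case empty
  show ?case by simp
next
  case (insert c D)
  have "f (insert c (S \<union> D)) - f (S \<union> D) \<le> f (insert c S) - f S"
    using insert assms(2) by (intro submodular_on_marginal_antimono[OF sub]) auto
  also have "\<dots> \<le> m" using insert.prems by blast
  finally have "f (insert c (S \<union> D)) - f (S \<union> D) \<le> m" .
  moreover have "f (S \<union> D) - f S \<le> real (card D) * m"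
    using insert by blast
  ultimately show ?case using insert.hyps by (simp add: algebra_simps)
qed

lemma greedy_reach_bounds:
  assumes "greedy_reach f Y k S" "finite Y"
  shows "S \<subseteq> Y \<and> card S \<le> k"
  using assms
proof (induction rule: greedy_reach.induct)
  case start
  show ?case by simp
next
  case (step S e)
  moreover from step have "e \<in> Y - S" by (simp add: is_arg_max_def)
  moreover from step have "finite S" using finite_subset by blast
  ultimately show ?case by auto
qed

text \<open>\<open>c\<close> was available at every earlier step, so each greedy gain was at least
  the marginal of \<open>c\<close> at that time, which is at least its marginal now. The gains
  telescope to \<open>f S - f {}\<close>.\<close>

lemma greedy_reach_card_marginal_le:
  assumes sub: "submodular_on \<Omega> f" and "finite Y" "Y \<subseteq> \<Omega>" "0 \<le> f {}"
    and "greedy_reach f Y k S" "c \<in> Y - S"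
  shows "real (card S) * (f (insert c S) - f S) \<le> f S"
  using assms(5,6)
proof (induction arbitrary: c rule: greedy_reach.induct)
  case start
  show ?case using assms(4) by simp
next
  case (step S e)
  have e: "e \<in> Y - S" and max: "\<And>c. c \<in> Y - S \<Longrightarrow> f (S \<union> {c}) \<le> f (S \<union> {e})"
    using step.hyps by (auto simp: is_arg_max_linorder)
  have S: "S \<subseteq> Y" "finite S"
    using greedy_reach_bounds[OF step.hyps(1) \<open>finite Y\<close>] \<open>finite Y\<close> finite_subset by blast+
  let ?m = "f (insert c (insert e S)) - f (insert e S)"
  have "?m \<le> f (insert c S) - f S"
    using step.prems e S assms(3) by (intro submodular_on_marginal_antimono[OF sub]) auto
  moreover from this have "real (card S) * ?m \<le> real (card S) * (f (insert c S) - f S)"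
    by (intro mult_left_mono) auto
  moreover have "real (card S) * (f (insert c S) - f S) \<le> f S"
    using step by auto
  moreover have "f (insert c S) \<le> f (insert e S)"
    using max[of c] step.prems by auto
  \<comment> \<open>The first \<open>card S\<close> copies of \<open>?m\<close> are paid for by
    \<open>f S\<close>, the additional one by the gain of \<open>e\<close>.\<close>
  ultimately have "(real (card S) + 1) * ?m \<le> f (insert e S)"
    by (simp add: distrib_right)
  then show ?case using e S by (simp add: add.commute)
qed

lemma greedy_output_union_le:
  assumes sub: "submodular_on \<Omega> f" and nonneg: "\<And>A. A \<subseteq> \<Omega> \<Longrightarrow> 0 \<le> f A"
    and "finite Y" "Y \<subseteq> \<Omega>" and out: "greedy_output f Y k S"
    and "C \<subseteq> Y" "card C \<le> k"
  shows "f (S \<union> C) \<le> 2 * f S"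
proof -
  have reach: "greedy_reach f Y k S" and fin: "card S = k \<or> S = Y"
    using out by (auto simp: greedy_output_def)
  have "S \<subseteq> Y" using greedy_reach_bounds[OF reach \<open>finite Y\<close>] by blast
  then have S: "S \<subseteq> \<Omega>" "0 \<le> f S" using assms(4) nonneg by auto
  show ?thesis
  proof (cases "C \<subseteq> S")
    case True
    then show ?thesis using S by (simp add: Un_absorb2)
  next
    case False
    \<comment> \<open>An element of \<open>C\<close> outside \<open>S\<close> shows that greedy did
      not exhaust \<open>Y\<close>, so it stopped at the cardinality bound.\<close>
    then have k: "card S = k" using fin \<open>C \<subseteq> Y\<close> by blast
    let ?D = "C - S" and ?g = "\<lambda>c. f (insert c S) - f S"
    have D: "finite ?D" "?D \<noteq> {}"
      using False \<open>C \<subseteq> Y\<close> \<open>finite Y\<close> finite_subset by blast+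
    define m where "m = Max (?g ` ?D)"
    have "m \<in> ?g ` ?D" unfolding m_def using D by (intro Max_in) auto
    then obtain d where d: "d \<in> ?D" "m = ?g d" by blast
    have "real k * m \<le> f S"
      using greedy_reach_card_marginal_le[OF sub assms(3,4) nonneg reach, of d] d k \<open>C \<subseteq> Y\<close>
      by auto
    moreover have "f (S \<union> ?D) - f S \<le> real (card ?D) * m"
      using D S assms(4) \<open>C \<subseteq> Y\<close>
      by (intro submodular_on_union_le[OF sub]) (auto simp: m_def)
    \<comment> \<open>Without monotonicity \<open>m\<close> can be negative; replacing
      \<open>card ?D\<close> by \<open>k\<close> would then fail, but the product is at most 0,
      hence at most \<open>f S\<close>.\<close>
    moreover have "real (card ?D) * m \<le> max 0 (real k * m)"
    proof (cases "0 \<le> m")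
      case True
      have "card ?D \<le> card C"
        using \<open>C \<subseteq> Y\<close> \<open>finite Y\<close> by (meson Diff_subset card_mono finite_subset)
      then have "real (card ?D) * m \<le> real k * m"
        using True assms(7) by (intro mult_right_mono) auto
      then show ?thesis by simp
    next
      case False
      then show ?thesis by (simp add: mult_nonneg_nonpos max.coboundedI1)
    qed
    ultimately show ?thesis using S by (simp add: max_def split: if_splits)
  qed
qed

lemma FMV_approxD:
  assumes "FMV_approx \<Omega> f \<alpha> FMV" "finite \<Omega>" "\<alpha> > 0" "S \<subseteq> \<Omega>" "T \<subseteq> S"
  shows "f T \<le> \<alpha> * f (FMV S)"
proof -
  have "finite (f ` Pow S)" using assms finite_subset by blast
  then have "f T \<le> Max (f ` Pow S)" using assms(5) by (intro Max_ge) auto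
  moreover have "Max (f ` Pow S) \<le> \<alpha> * f (FMV S)"
    using assms by (auto simp: FMV_approx_def field_simps)
  ultimately show ?thesis by linarith
qed

lemma OPT_attained:
  assumes "finite X"
  shows "\<exists>C \<subseteq> X. card C \<le> k \<and> OPT f X k = f C"
proof -
  let ?F = "{C. C \<subseteq> X \<and> card C \<le> k}"
  have "finite ?F" using assms by simp
  moreover have "{} \<in> ?F" by simp
  ultimately have "Max (f ` ?F) \<in> f ` ?F" by (intro Max_in) blast+
  then show ?thesis unfolding OPT_def by blast
qed

theorem theorem1:
  fixes \<Omega> X S :: "'a set" and f :: "'a set \<Rightarrow> real" and FMV :: "'a set \<Rightarrow> 'a set"
    and k :: nat and \<alpha> :: real
  assumes "finite \<Omega>"
    and "submodular_on \<Omega> f"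
    and "\<And>A. A \<subseteq> \<Omega> \<Longrightarrow> f A \<ge> 0"
    and "f {} = 0"
    and "X \<subseteq> \<Omega>"
    and "k > 0"
    and "\<alpha> \<ge> 1"
    and "FMV_approx \<Omega> f \<alpha> FMV"
    and "submod_max_cardinality f FMV X k S"
  shows "S \<subseteq> X \<and> card S \<le> k \<and> f S \<ge> (1 / (4 + \<alpha>)) * OPT f X k"
proof -
  note sub = assms(2) and nonneg = assms(3)
  have finX: "finite X" using assms(1,5) finite_subset by blast
  from assms(9) obtain Xs Ss S' where run: "Xs (1::nat) = X"
      "\<forall>i\<in>{1, 2}. greedy_output f (Xs i) k (Ss i) \<and> S' i = FMV (Ss i) \<and> Xs (i + 1) = Xs i - Ss i"
      "is_arg_max f (\<lambda>T. T \<in> {Ss 1, S' 1, Ss 2}) S"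
    unfolding submod_max_cardinality_def by blast
  define S1 S2 where "S1 = Ss 1" and "S2 = Ss 2"
  have out1: "greedy_output f X k S1" and out2: "greedy_output f (X - S1) k S2"
    and S'1: "S' 1 = FMV S1"
    using run(1,2) by (auto simp: S1_def S2_def numeral_2_eq_2)
  have max: "S \<in> {S1, FMV S1, S2}" "f S1 \<le> f S" "f (FMV S1) \<le> f S" "f S2 \<le> f S"
    using run(3) S'1 by (auto simp: is_arg_max_linorder S1_def S2_def)
  have S1: "S1 \<subseteq> X" "card S1 \<le> k" and S2: "S2 \<subseteq> X - S1" "card S2 \<le> k"
    using out1 out2 greedy_reach_bounds[of f X k S1] greedy_reach_bounds[of f "X - S1" k S2] finX
    by (auto simp: greedy_output_def)
  have F: "FMV S1 \<subseteq> S1" using assms(5,8) S1 by (auto simp: FMV_approx_def)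
  then have "card (FMV S1) \<le> card S1"
    using S1 finX by (meson card_mono finite_subset)
  with F S1 S2 max(1) have feasible: "S \<subseteq> X \<and> card S \<le> k" by auto
  obtain C where C: "C \<subseteq> X" "card C \<le> k" "OPT f X k = f C"
    using OPT_attained[OF finX] by blast
  have cD: "card (C - S1) \<le> k"
    using C finX by (meson Diff_subset card_mono finite_subset le_trans)
  have sets: "S1 \<subseteq> \<Omega>" "S2 \<subseteq> \<Omega>" "C \<subseteq> \<Omega>" using S1 S2 C assms(5) by auto
  have "f (S1 \<union> C) \<le> 2 * f S1"
    using out1 C finX assms(5) by (intro greedy_output_union_le[OF sub nonneg])
  moreover have "f (S2 \<union> (C - S1)) \<le> 2 * f S2"
    using finX assms(5) C cD
    by (intro greedy_output_union_le[OF sub nonneg _ _ out2]) auto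
  moreover have "f (C - S1) \<le> f (S1 \<union> C) + f (S2 \<union> (C - S1))"
  proof -
    \<comment> \<open>Disjointness of \<open>S1\<close> and \<open>S2\<close> leaves only
      \<open>C - S1\<close> in the intersection; the value of the union is discarded by
      nonnegativity.\<close>
    have "(S1 \<union> C) \<inter> (S2 \<union> (C - S1)) = C - S1" using S2 by auto
    moreover have "0 \<le> f ((S1 \<union> C) \<union> (S2 \<union> (C - S1)))" using sets by (intro nonneg) auto
    moreover have "S1 \<union> C \<subseteq> \<Omega>" "S2 \<union> (C - S1) \<subseteq> \<Omega>" using sets by auto
    ultimately show ?thesis
      using submodular_onD[OF sub, of "S1 \<union> C" "S2 \<union> (C - S1)"] by simp
  qed
  moreover have "f C \<le> f (C - S1) + f (C \<inter> S1)"
  proof -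
    have "(C - S1) \<union> (C \<inter> S1) = C" "(C - S1) \<inter> (C \<inter> S1) = {}" by auto
    moreover have "C - S1 \<subseteq> \<Omega>" "C \<inter> S1 \<subseteq> \<Omega>" using sets by auto
    ultimately show ?thesis
      using submodular_onD[OF sub, of "C - S1" "C \<inter> S1"] assms(4) by simp
  qed
  moreover have "f (C \<inter> S1) \<le> \<alpha> * f (FMV S1)"
    using FMV_approxD[OF assms(8,1), of S1 "C \<inter> S1"] assms(7) sets by auto
  moreover have "\<alpha> * f (FMV S1) \<le> \<alpha> * f S"
    using max assms(7) by (intro mult_left_mono) auto
  \<comment> \<open>Each of the two greedy sets contributes 2 to the factor, and the part of
    \<open>C\<close> inside \<open>S1\<close> contributes \<alpha>.\<close>
  ultimately have "f C \<le> (4 + \<alpha>) * f S"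
    using max by (simp add: distrib_right)
  then have "(1 / (4 + \<alpha>)) * OPT f X k \<le> f S"
    using assms(7) C(3) by (simp add: field_simps)
  with feasible show ?thesis by blast
qed

end
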